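(* Up to isomorphism of skew braces, the finite left-simple skew braces with an abelian additive group are exactly the skew braces $\mathbb{F}_p=(\mathbb{F}_p,+,+)$, where $p$ is any prime and $+$ is the usual addition of the field $\mathbb{F}_p$ with $p$ elements.
   Context: A skew brace is a set $A=(A,\cdot,\circ)$ equipped with two group operations $\cdot$ and $\circ$ such that $a\circ(b\cdot c)=(a\circ b)\cdot a^{-1}\cdot(a\circ c)$ for all $a,b,c\in A$, where $a^{-1}$ denotes the inverse of $a$ in $(A,\cdot)$. The two groups share the same identity $1$. The group $(A,\cdot)$ is called the additive group of $A$. An isomorphism of skew braces is a bijection that is a homomorphism with respect to both operations. For $a\in A$, the map $\lambda_a:A\to A$, $\lambda_a(x)=a^{-1}\cdot(a\circ x)$, is an automorphism of $(A,\cdot)$. A left ideal of $A$ is a subgroup $I$ of $(A,\cdot)$ such that $\lambda_a(I)\subseteq I$ for all $a\in A$. A skew brace $A$ is left-simple if $A\neq 1$ and $A$ has no left ideal other than $1$ and $A$. *)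

theory Defs
  imports "HOL-Algebra.Group" "HOL-Number_Theory.Residues"
begin

text \<open>
  The inherited monoid fields carry the additive group, which is written multiplicatively;
  \<open>circ\<close> is the second operation. A separate unit for \<open>circ\<close> is not recorded:
  the lemma \<open>skew_brace_same_identity\<close> below shows that the identities of the two groups
  necessarily coincide.
\<close>

record 'a skew_brace = "'a monoid" +
  circ :: "'a \<Rightarrow> 'a \<Rightarrow> 'a" (infixl \<open>\<circledcirc>\<index>\<close> 70)

definition circ_group :: "('a, 'b) skew_brace_scheme \<Rightarrow> 'a monoid" where
  "circ_group A = \<lparr>carrier = carrier A, monoid.mult = circ A, one = \<one>\<^bsub>A\<^esub>\<rparr>"

locale skew_brace = group A + circ: group "circ_group A"
    for A :: "('a, 'b) skew_brace_scheme" (structure) +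
  assumes circ_distrib:
    "\<lbrakk>a \<in> carrier A; b \<in> carrier A; c \<in> carrier A\<rbrakk>
      \<Longrightarrow> a \<circledcirc> (b \<otimes> c) = (a \<circledcirc> b) \<otimes> inv a \<otimes> (a \<circledcirc> c)"

lemma skew_brace_same_identity:
  assumes "group G" "group H" "carrier H = carrier G"
    and distrib: "\<And>a b c. \<lbrakk>a \<in> carrier G; b \<in> carrier G; c \<in> carrier G\<rbrakk>
      \<Longrightarrow> a \<otimes>\<^bsub>H\<^esub> (b \<otimes>\<^bsub>G\<^esub> c) = (a \<otimes>\<^bsub>H\<^esub> b) \<otimes>\<^bsub>G\<^esub> inv\<^bsub>G\<^esub> a \<otimes>\<^bsub>G\<^esub> (a \<otimes>\<^bsub>H\<^esub> c)"
  shows "\<one>\<^bsub>H\<^esub> = \<one>\<^bsub>G\<^esub>"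
proof -
  interpret G: group G by fact
  interpret H: group H by fact
  have e: "\<one>\<^bsub>H\<^esub> \<in> carrier G" using H.one_closed assms(3) by simp
  have "\<one>\<^bsub>G\<^esub> = inv\<^bsub>G\<^esub> \<one>\<^bsub>H\<^esub>"
    using distrib[OF e G.one_closed G.one_closed] e assms(3) by simp
  then show ?thesis using e by (metis G.inv_inv G.inv_one)
qed

definition lambda_map :: "('a, 'b) skew_brace_scheme \<Rightarrow> 'a \<Rightarrow> 'a \<Rightarrow> 'a" where
  "lambda_map A a x = inv\<^bsub>A\<^esub> a \<otimes>\<^bsub>A\<^esub> (a \<circledcirc>\<^bsub>A\<^esub> x)"

definition left_ideal :: "'a set \<Rightarrow> ('a, 'b) skew_brace_scheme \<Rightarrow> bool" where
  "left_ideal I A \<longleftrightarrow> subgroup I A \<and> (\<forall>a \<in> carrier A. lambda_map A a ` I \<subseteq> I)"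

definition left_simple :: "('a, 'b) skew_brace_scheme \<Rightarrow> bool" where
  "left_simple A \<longleftrightarrow>
     carrier A \<noteq> {\<one>\<^bsub>A\<^esub>} \<and> (\<forall>I. left_ideal I A \<longrightarrow> I = {\<one>\<^bsub>A\<^esub>} \<or> I = carrier A)"

definition skew_brace_iso ::
    "('a, 'c) skew_brace_scheme \<Rightarrow> ('b, 'd) skew_brace_scheme \<Rightarrow> ('a \<Rightarrow> 'b) set" where
  "skew_brace_iso A B = iso A B \<inter> iso (circ_group A) (circ_group B)"

definition skew_brace_isomorphic ::
    "('a, 'c) skew_brace_scheme \<Rightarrow> ('b, 'd) skew_brace_scheme \<Rightarrow> bool" where
  "skew_brace_isomorphic A B \<longleftrightarrow> skew_brace_iso A B \<noteq> {}"

definition F_brace :: "nat \<Rightarrow> int skew_brace" where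
  "F_brace p =
     \<lparr>carrier = carrier (residue_ring (int p)),
      monoid.mult = add (residue_ring (int p)),
      one = zero (residue_ring (int p)),
      circ = add (residue_ring (int p))\<rparr>"

end

theory Submission
  imports Defs "HOL-Algebra.Sylow" "HOL-Algebra.Group_Action" "HOL-Algebra.Elementary_Groups"
begin

text \<open>
  Let \<open>A\<close> be a finite left-simple skew brace whose additive group is abelian. The idea is that
  left-simplicity forces every canonically defined subgroup to be trivial or everything, and that
  two such subgroups suffice.

  Choose a prime \<open>p\<close> dividing \<open>|A|\<close>. In an abelian group the elements \<open>x\<close> with \<open>x\<^sup>p = 1\<close> form a
  subgroup, which every automorphism preserves, so it is a left ideal
  (\<open>torsion_left_ideal\<close>). By Cauchy's theorem it is not trivial, so it is all of \<open>A\<close>. By Cauchy's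
  theorem again, \<open>p\<close> is then the only prime dividing \<open>|A|\<close>.

  Now \<open>(A, \<circ>)\<close> has the same order as the additive group, so it is a \<open>p\<close>-group, and it acts on the set
  \<open>A\<close> through \<open>\<lambda>\<close> (\<open>lambda_action\<close>). The non-fixed points fall into orbits of size divisible by
  \<open>p\<close>, so \<open>p\<close> divides the number of fixed points
  (\<open>prime_dvd_card_fixed_points\<close>). As \<open>1\<close> is fixed, there are others; and
  since the fixed points form a left ideal (\<open>fixed_points_left_ideal\<close>), everything is fixed. Thus
  \<open>\<lambda>\<close> is trivial and the two operations coincide. Every additive subgroup is now a left ideal, so
  \<open>A\<close> is generated by any element of order \<open>p\<close>, and \<open>k \<mapsto> g\<^sup>k\<close> identifies \<open>F\<^sub>p\<close> with \<open>A\<close>. This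
  elementary argument takes the place of the solvability of \<open>(A, \<circ>)\<close> and of Hall subgroups.

  Conversely, a left ideal is an additive subgroup, so by Lagrange's theorem every skew brace of
  prime order is left-simple.
\<close>

section \<open>Group-theoretic preliminaries\<close>

text \<open>
  Cauchy's theorem, from the Sylow theorem with exponent \<open>1\<close>: a subgroup of prime order \<open>q\<close>
  has an element other than the identity, whose order divides \<open>q\<close> and is not \<open>1\<close>.
\<close>

lemma (in group) Cauchy_element_of_prime_order:
  assumes fin: "finite (carrier G)" and q: "prime q" and dvd: "q dvd order G"
  shows "\<exists>x\<in>carrier G. ord x = q"
proof -
  obtain m where "order G = q ^ 1 * m" using dvd by auto
  then obtain H where H: "subgroup H G" "card H = q"
    using sylow_thm[OF q is_group, of 1 m] fin by auto
  interpret H: group "G\<lparr>carrier := H\<rparr>"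
    using H(1) by (rule subgroup_imp_group)
  have "H \<noteq> {\<one>}"
    using H(2) q by (metis card_1_singleton_iff not_prime_1 One_nat_def)
  then obtain x where x: "x \<in> H" "x \<noteq> \<one>"
    using subgroup.one_closed[OF H(1)] by blast
  have xG: "x \<in> carrier G" using x(1) subgroup.mem_carrier[OF H(1)] by blast
  have "x [^]\<^bsub>G\<lparr>carrier := H\<rparr>\<^esub> order (G\<lparr>carrier := H\<rparr>) = \<one>"
    using H.pow_order_eq_1[of x] x(1) by simp
  then have "x [^] q = \<one>"
    by (simp add: order_def H(2) nat_pow_def)
  then have "ord x dvd q" using pow_eq_id[OF xG] by simp
  moreover have "ord x \<noteq> 1" using ord_eq_1[OF xG] x(2) by simp
  ultimately have "ord x = q" using q by (metis prime_nat_iff)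
  then show ?thesis using xG by blast
qed

text \<open>
  The fixed-point congruence for actions of \<open>p\<close>-groups. The orbit of a non-fixed point has more than
  one element and its size divides the group order, so it is a multiple of \<open>p\<close>; these orbits
  partition the set of non-fixed points. The hypothesis on the prime divisors of the group order
  says that the group is a \<open>p\<close>-group without naming the exponent.
\<close>

lemma (in group_action) prime_dvd_card_fixed_points:
  assumes finG: "finite (carrier G)" and finE: "finite E"
    and p_group: "\<And>q. prime q \<Longrightarrow> q dvd order G \<Longrightarrow> q = p"
    and dvd: "p dvd card E"
  shows "p dvd card {x \<in> E. \<forall>g\<in>carrier G. \<phi> g x = x}"
proof -
  let ?F = "{x \<in> E. \<forall>g\<in>carrier G. \<phi> g x = x}"
  let ?C = "orbit G \<phi> ` (E - ?F)"
  have orbit_E: "orbit G \<phi> x \<subseteq> E" if "x \<in> E" for x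
    using that element_image by (auto simp: orbit_def)
  have non_fixed: "orbit G \<phi> x \<subseteq> E - ?F" if x: "x \<in> E - ?F" for x
  proof
    fix y assume y: "y \<in> orbit G \<phi> x"
    then have yE: "y \<in> E" using orbit_E x by blast
    have "x \<in> orbit G \<phi> y" using orbit_sym[of x y] x y yE by blast
    then have "y \<in> ?F \<Longrightarrow> x = y" by (auto simp: orbit_def)
    then show "y \<in> E - ?F" using x yE by blast
  qed
  have union: "\<Union>?C = E - ?F"
    using non_fixed orbit_refl by blast
  have "p dvd card c" if c: "c \<in> ?C" for c
  proof -
    obtain x where x: "x \<in> E" "x \<notin> ?F" "c = orbit G \<phi> x"
      using c by blast
    obtain g where g: "g \<in> carrier G" "\<phi> g x \<noteq> x" using x by blast
    have "x \<in> c" "\<phi> g x \<in> c" using x g orbit_refl by (auto simp: orbit_def)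
    then have "card c \<noteq> 1" using g(2) by (metis card_1_singletonE singletonD)
    then obtain q where q: "prime q" "q dvd card c" using prime_factor_nat by blast
    have "card c dvd order G" using orbit_stabilizer_theorem[OF x(1)] x(3) by (metis dvd_triv_left)
    then show ?thesis using p_group q dvd_trans by blast
  qed
  moreover have "c \<inter> d = {}" if "c \<in> ?C" "d \<in> ?C" "c \<noteq> d" for c d
    using that disjoint_union[of c d] unfolding orbits_def by blast
  ultimately have "p dvd card (\<Union>?C)"
    using finE union by (intro dvd_partition) auto
  then have "p dvd card E - card ?F"
    using union finE by (simp add: card_Diff_subset)
  then show ?thesis
    using dvd by (rule dvd_diffD1) (use finE in \<open>auto intro: card_mono\<close>)
qed

section \<open>The action of a skew brace on its additive group\<close>

lemma circ_group_simps [simp]: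
  "carrier (circ_group A) = carrier A"
  "x \<otimes>\<^bsub>circ_group A\<^esub> y = x \<circledcirc>\<^bsub>A\<^esub> y"
  "\<one>\<^bsub>circ_group A\<^esub> = \<one>\<^bsub>A\<^esub>"
  by (simp_all add: circ_group_def)

context skew_brace
begin

lemma circ_closed [simp]: "a \<in> carrier A \<Longrightarrow> b \<in> carrier A \<Longrightarrow> a \<circledcirc> b \<in> carrier A"
  using circ.m_closed[of a b] by simp

lemma lambda_closed [simp]:
  "a \<in> carrier A \<Longrightarrow> x \<in> carrier A \<Longrightarrow> lambda_map A a x \<in> carrier A"
  by (simp add: lambda_map_def)

lemma circ_eq_mult_lambda:
  "a \<in> carrier A \<Longrightarrow> x \<in> carrier A \<Longrightarrow> a \<circledcirc> x = a \<otimes> lambda_map A a x"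
  by (simp add: lambda_map_def flip: m_assoc)

lemma lambda_mult:
  assumes "a \<in> carrier A" "x \<in> carrier A" "y \<in> carrier A"
  shows "lambda_map A a (x \<otimes> y) = lambda_map A a x \<otimes> lambda_map A a y"
  using assms by (simp add: lambda_map_def circ_distrib m_assoc)

lemma lambda_in_hom: "a \<in> carrier A \<Longrightarrow> lambda_map A a \<in> hom A A"
  by (simp add: hom_def lambda_mult)

lemma lambda_group_hom: "a \<in> carrier A \<Longrightarrow> group_hom A A (lambda_map A a)"
  by (simp add: group_hom_def group_hom_axioms_def lambda_in_hom)

lemma lambda_one: "x \<in> carrier A \<Longrightarrow> lambda_map A \<one> x = x"
  using circ.l_one[of x] by (simp add: lambda_map_def)

text \<open>
  This is associativity of \<open>\<circ>\<close> in disguise: by \<open>circ_eq_mult_lambda\<close> and the brace law, both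
  bracketings of \<open>a \<circ> b \<circ> x\<close> are the product of \<open>a \<circ> b\<close> with one of the two sides.
\<close>

lemma lambda_circ:
  assumes a: "a \<in> carrier A" and b: "b \<in> carrier A" and x: "x \<in> carrier A"
  shows "lambda_map A (a \<circledcirc> b) x = lambda_map A a (lambda_map A b x)"
proof -
  have "(a \<circledcirc> b) \<otimes> lambda_map A (a \<circledcirc> b) x = a \<circledcirc> (b \<circledcirc> x)"
    using circ.m_assoc[of a b x] a b x by (simp flip: circ_eq_mult_lambda)
  also have "\<dots> = a \<circledcirc> (b \<otimes> lambda_map A b x)"
    using b x by (simp add: circ_eq_mult_lambda)
  also have "\<dots> = (a \<circledcirc> b) \<otimes> lambda_map A a (lambda_map A b x)"
    using a b x by (simp add: circ_distrib lambda_map_def[of A a] m_assoc)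
  finally show ?thesis using a b x by simp
qed

text \<open>
  The library's group actions are homomorphisms into the group of extensional bijections of
  a set, whence the restriction to the carrier.
\<close>

lemma lambda_action:
  "group_action (circ_group A) (carrier A) (\<lambda>a. restrict (lambda_map A a) (carrier A))"
proof -
  let ?\<phi> = "\<lambda>a. restrict (lambda_map A a) (carrier A)"
  have bij: "?\<phi> a \<in> Bij (carrier A)" if a: "a \<in> carrier A" for a
  proof -
    let ?b = "inv\<^bsub>circ_group A\<^esub> a"
    have b: "?b \<in> carrier A" "a \<circledcirc> ?b = \<one>" "?b \<circledcirc> a = \<one>"
      using circ.inv_closed[of a] circ.r_inv[of a] circ.l_inv[of a] a by simp_all
    have "bij_betw (lambda_map A a) (carrier A) (carrier A)"
      by (rule bij_betw_byWitness[where f' = "lambda_map A ?b"])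
        (use a b in \<open>auto simp: lambda_one simp flip: lambda_circ\<close>)
    then show ?thesis by (simp add: Bij_def)
  qed
  have "?\<phi> \<in> hom (circ_group A) (BijGroup (carrier A))"
    by (rule homI) (auto simp: bij BijGroup_def compose_def fun_eq_iff lambda_circ)
  then show ?thesis
    unfolding group_action_def group_hom_def group_hom_axioms_def
    using circ.is_group group_BijGroup by blast
qed

text \<open>
  The fixed points form a subgroup because each \<open>\<lambda>\<^sub>a\<close> is an endomorphism of the additive group; they
  are \<open>\<lambda>\<close>-stable because \<open>\<lambda>\<close> does not move them.
\<close>

lemma fixed_points_left_ideal:
  "left_ideal {x \<in> carrier A. \<forall>a\<in>carrier A. lambda_map A a x = x} A"
  unfolding left_ideal_def
proof (intro conjI ballI)
  show "subgroup {x \<in> carrier A. \<forall>a\<in>carrier A. lambda_map A a x = x} A"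
  proof (rule subgroupI)
    have "lambda_map A a \<one> = \<one>" if "a \<in> carrier A" for a
      using lambda_group_hom[OF that] by (rule group_hom.hom_one)
    then show "{x \<in> carrier A. \<forall>a\<in>carrier A. lambda_map A a x = x} \<noteq> {}" by blast
  qed (simp_all add: lambda_mult group_hom.hom_inv[OF lambda_group_hom])
qed auto

text \<open>
  Commutativity makes the \<open>n\<close>-torsion closed under products; any endomorphism of the
  additive group, in particular \<open>\<lambda>\<^sub>a\<close>, preserves it.
\<close>

lemma torsion_left_ideal:
  assumes "comm_group A"
  shows "left_ideal {x \<in> carrier A. x [^] (n::nat) = \<one>} A"
  unfolding left_ideal_def
proof (intro conjI ballI)
  interpret comm_group A by fact
  show "subgroup {x \<in> carrier A. x [^] n = \<one>} A"
  proof (rule subgroupI)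
    show "{x \<in> carrier A. x [^] n = \<one>} \<noteq> {}" using nat_pow_one by blast
    fix x y assume xy: "x \<in> {x \<in> carrier A. x [^] n = \<one>}" "y \<in> {x \<in> carrier A. x [^] n = \<one>}"
    then have "(x \<otimes> y) [^] n = x [^] n \<otimes> y [^] n"
      using pow_mult_distrib[of x y n] m_comm[of x y] by blast
    then show "x \<otimes> y \<in> {x \<in> carrier A. x [^] n = \<one>}" using xy by simp
  qed (use nat_pow_inv in auto)
  show "lambda_map A a ` {x \<in> carrier A. x [^] n = \<one>} \<subseteq> {x \<in> carrier A. x [^] n = \<one>}"
    if a: "a \<in> carrier A" for a
  proof -
    interpret lam: group_hom A A "lambda_map A a" using a by (rule lambda_group_hom)
    have "lambda_map A a x [^] n = \<one>" if "x \<in> carrier A" "x [^] n = \<one>" for x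
      using lam.hom_nat_pow[of x n] that by simp
    then show ?thesis using a by auto
  qed
qed

end

section \<open>Finite left-simple skew braces of abelian type\<close>

text \<open>
  The \<open>p\<close>-torsion is a left ideal, and it contains an element of order \<open>p\<close> by Cauchy's theorem, so
  it can only be the whole skew brace.
\<close>

lemma (in skew_brace) left_simple_prime_exponent:
  assumes fin: "finite (carrier A)" and simple: "left_simple A" and comm: "comm_group A"
  obtains p :: nat where "prime p" "p dvd order A" "\<And>x. x \<in> carrier A \<Longrightarrow> x [^] p = \<one>"
proof -
  have "order A \<noteq> 1"
  proof
    assume "order A = 1"
    then obtain z where "carrier A = {z}" by (auto simp: order_def card_1_singleton_iff)
    then show False using simple one_closed by (auto simp: left_simple_def)
  qed
  then obtain p where p: "prime p" "p dvd order A" using prime_factor_nat by blast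
  obtain x where x: "x \<in> carrier A" "ord x = p"
    using Cauchy_element_of_prime_order[OF fin p] by blast
  have "x \<noteq> \<one>" using x p(1) by auto
  moreover have "x [^] p = \<one>" using x pow_ord_eq_1 by metis
  ultimately have "{x \<in> carrier A. x [^] p = \<one>} = carrier A"
    using simple torsion_left_ideal[OF comm, of p] x(1) unfolding left_simple_def by blast
  then show ?thesis using p that by blast
qed

text \<open>
  The exponent \<open>p\<close> makes the additive group, and hence also \<open>(A, \<circ>)\<close>, which has the same
  carrier, a \<open>p\<close>-group. The number of points fixed by \<open>\<lambda>\<close> is then divisible by \<open>p\<close>, so the left
  ideal of fixed points is not trivial.
\<close>

lemma (in skew_brace) left_simple_lambda_trivial:
  assumes fin: "finite (carrier A)" and simple: "left_simple A"
    and p: "prime p" "p dvd order A" and exp: "\<And>x. x \<in> carrier A \<Longrightarrow> x [^] p = \<one>"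
    and a: "a \<in> carrier A" and x: "x \<in> carrier A"
  shows "lambda_map A a x = x"
proof -
  let ?F = "{x \<in> carrier A. \<forall>a\<in>carrier A. lambda_map A a x = x}"
  interpret act: group_action "circ_group A" "carrier A"
    "\<lambda>a. restrict (lambda_map A a) (carrier A)" by (rule lambda_action)
  have primes: "q = p" if q: "prime q" "q dvd order A" for q
  proof -
    obtain y where y: "y \<in> carrier A" "ord y = q"
      using Cauchy_element_of_prime_order[OF fin q] by blast
    then have "q dvd p" using exp pow_eq_id by blast
    then show ?thesis using p(1) q(1) primes_dvd_imp_eq by blast
  qed
  have "p dvd card ?F"
    using act.prime_dvd_card_fixed_points[of p] fin primes p(2)
    by (simp add: order_def cong: conj_cong)
  then have "card ?F \<noteq> 1" using p(1) by auto
  then have "?F \<noteq> {\<one>}" by (metis card_1_singleton_iff One_nat_def)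
  then have "?F = carrier A"
    using simple fixed_points_left_ideal unfolding left_simple_def by blast
  then show ?thesis using a x by blast
qed

text \<open>
  If \<open>\<lambda>\<close> is trivial, then every additive subgroup is a left ideal, in particular the one generated
  by \<open>g\<close>.
\<close>

lemma (in skew_brace) left_simple_imp_cyclic:
  assumes simple: "left_simple A"
    and trivial: "\<And>a x. a \<in> carrier A \<Longrightarrow> x \<in> carrier A \<Longrightarrow> lambda_map A a x = x"
    and g: "g \<in> carrier A" "g \<noteq> \<one>"
  shows "carrier A = range (\<lambda>k::int. g [^] k)"
proof -
  have "subgroup (generate A {g}) A" using g by (intro generate_is_subgroup) auto
  then have "left_ideal (generate A {g}) A"
    unfolding left_ideal_def using trivial subgroup.mem_carrier by fastforce
  moreover have "g \<in> generate A {g}" by (auto intro: generate.incl)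
  ultimately have "generate A {g} = carrier A" using simple g unfolding left_simple_def by blast
  then show ?thesis using generate_pow[OF g(1)] by (auto simp: full_SetCompr_eq)
qed

text \<open>
  By Lagrange's theorem a group of prime order has no proper nontrivial subgroup at all.
\<close>

lemma left_simple_prime_order:
  assumes A: "group A" and p: "prime (order A)"
  shows "left_simple A"
  unfolding left_simple_def
proof (intro conjI allI impI)
  interpret group A by fact
  have fin: "finite (carrier A)" by (rule ccontr) (use p in \<open>simp add: order_def\<close>)
  show "carrier A \<noteq> {\<one>\<^bsub>A\<^esub>}" using p by (auto simp: order_def)
  fix I assume "left_ideal I A"
  then have I: "subgroup I A" by (simp add: left_ideal_def)
  have "card I dvd order A" using lagrange[OF I] by (metis dvd_triv_right)
  then consider "card I = 1" | "card I = order A" using p by (auto simp: prime_nat_iff)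
  then show "I = {\<one>\<^bsub>A\<^esub>} \<or> I = carrier A"
  proof cases
    case 1
    then show ?thesis using subgroup.one_closed[OF I] by (auto simp: card_1_singleton_iff)
  next
    case 2
    then show ?thesis using card_subset_eq[OF fin subgroup.subset[OF I]] by (simp add: order_def)
  qed
qed

section \<open>The skew braces of prime order\<close>

lemma F_brace_simps:
  assumes "prime p"
  shows "carrier (F_brace p) = {0..<int p}"
    and "x \<otimes>\<^bsub>F_brace p\<^esub> y = (x + y) mod int p"
    and "\<one>\<^bsub>F_brace p\<^esub> = 0"
    and "x \<circledcirc>\<^bsub>F_brace p\<^esub> y = (x + y) mod int p"
  by (auto simp: F_brace_def residue_ring_def)

text \<open>
  On the carrier \<open>{0..<p}\<close> the operation is that of \<^term>\<open>integer_mod_group p\<close>. The two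
  structures have different record types, so the group laws are carried over one at a time.
\<close>

lemma F_brace_comm_group:
  assumes p: "prime p"
  shows "comm_group (F_brace p)"
proof -
  interpret Z: comm_group "integer_mod_group p" by simp
  have car: "carrier (integer_mod_group p) = {0..<int p}"
    using prime_gt_0_nat[OF p] by (simp add: carrier_integer_mod_group)
  show ?thesis
  proof (rule comm_groupI)
    fix x y z
    assume "x \<in> carrier (F_brace p)" "y \<in> carrier (F_brace p)" "z \<in> carrier (F_brace p)"
    then show "x \<otimes>\<^bsub>F_brace p\<^esub> y \<otimes>\<^bsub>F_brace p\<^esub> z = x \<otimes>\<^bsub>F_brace p\<^esub> (y \<otimes>\<^bsub>F_brace p\<^esub> z)"
      using Z.m_assoc[of x y z] p by (simp add: F_brace_simps car)
  next
    fix x assume "x \<in> carrier (F_brace p)"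
    then show "\<exists>y\<in>carrier (F_brace p). y \<otimes>\<^bsub>F_brace p\<^esub> x = \<one>\<^bsub>F_brace p\<^esub>"
      using Z.l_inv_ex[of x] p by (simp add: F_brace_simps car)
  qed (use prime_gt_0_nat[OF p] in \<open>auto simp: F_brace_simps[OF p] add.commute\<close>)
qed

text \<open>
  When the operations coincide, the brace law reduces to \<open>a b a\<^sup>-\<^sup>1 a c = a b c\<close>.
\<close>

lemma trivial_skew_brace:
  fixes A (structure)
  assumes "group A" and eq: "circ A = monoid.mult A"
  shows "skew_brace A"
proof -
  interpret group A by fact
  have "group (circ_group A)"
    by (rule groupI) (auto simp: eq m_assoc intro: l_inv_ex)
  moreover have "a \<otimes> b \<otimes> inv a \<otimes> (a \<otimes> c) = a \<otimes> (b \<otimes> c)"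
    if "a \<in> carrier A" "b \<in> carrier A" "c \<in> carrier A" for a b c
    using that by (simp add: m_assoc flip: m_assoc[of "inv a" a c])
  ultimately show ?thesis
    by (simp add: skew_brace_def skew_brace_axioms_def eq is_group)
qed

lemma F_brace_skew_brace: "prime p \<Longrightarrow> skew_brace (F_brace p)"
  using F_brace_comm_group[of p]
  by (intro trivial_skew_brace) (auto simp: comm_group_def F_brace_def)

lemma skew_brace_isomorphic_sym:
  assumes "skew_brace A" "skew_brace B" "skew_brace_isomorphic A B"
  shows "skew_brace_isomorphic B A"
proof -
  interpret A: skew_brace A by fact
  interpret B: skew_brace B by fact
  obtain f where f: "f \<in> iso A B" "f \<in> iso (circ_group A) (circ_group B)"
    using assms(3) by (auto simp: skew_brace_isomorphic_def skew_brace_iso_def)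
  have "inv_into (carrier A) f \<in> skew_brace_iso B A"
    using A.iso_set_sym[OF f(1)] A.circ.iso_set_sym[OF f(2)] by (simp add: skew_brace_iso_def)
  then show ?thesis by (auto simp: skew_brace_isomorphic_def)
qed

text \<open>
  The isomorphism is more easily given from \<open>F_brace p\<close> to \<open>A\<close>, as \<open>k \<mapsto> g\<^sup>k\<close>: it respects
  addition modulo \<open>p\<close> because \<open>g\<close> has order \<open>p\<close>.
\<close>

lemma (in skew_brace) cyclic_trivial_isomorphic_F_brace:
  assumes p: "prime p" and g: "g \<in> carrier A" "ord g = p"
    and cyclic: "carrier A = range (\<lambda>k::int. g [^] k)"
    and trivial: "\<And>a x. a \<in> carrier A \<Longrightarrow> x \<in> carrier A \<Longrightarrow> a \<circledcirc> x = a \<otimes> x"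
  shows "skew_brace_isomorphic A (F_brace p)"
proof (rule skew_brace_isomorphic_sym[OF F_brace_skew_brace[OF p]])
  show "skew_brace A" by unfold_locales
  let ?f = "\<lambda>k::int. g [^] k"
  have pow_mod: "g [^] (k mod int p) = g [^] k" for k :: int
    using int_pow_eq[OF g(1)] g(2) by (simp add: minus_mod_eq_mult_div)
  have hom: "g [^] ((x + y) mod int p) = g [^] x \<otimes> g [^] y" for x y :: int
    using pow_mod int_pow_mult[OF g(1)] by simp
  have inj: "inj_on ?f {0..<int p}"
  proof (rule inj_onI)
    fix x y :: int
    assume "x \<in> {0..<int p}" "y \<in> {0..<int p}" "g [^] x = g [^] y"
    then show "x = y"
      using int_pow_eq[OF g(1), of x y] g(2) mod_eq_dvd_iff[of y "int p" x] by auto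
  qed
  have "carrier A \<subseteq> ?f ` {0..<int p}"
  proof
    fix a assume "a \<in> carrier A"
    then obtain k :: int where "a = g [^] k" using cyclic by auto
    then show "a \<in> ?f ` {0..<int p}"
      using pow_mod[of k] prime_gt_0_nat[OF p] by (intro image_eqI[of _ _ "k mod int p"]) auto
  qed
  then have "bij_betw ?f {0..<int p} (carrier A)"
    using inj g(1) by (auto simp: bij_betw_def)
  then have "?f \<in> skew_brace_iso (F_brace p) A"
    using g(1) by (auto simp: skew_brace_iso_def iso_def hom_def F_brace_simps[OF p] hom trivial)
  then show "skew_brace_isomorphic (F_brace p) A" by (auto simp: skew_brace_isomorphic_def)
qed

section \<open>The classification\<close>

lemma (in skew_brace) left_simple_abelian_isomorphic_F_brace:
  assumes fin: "finite (carrier A)" and simple: "left_simple A" and comm: "comm_group A"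
  shows "\<exists>p. prime p \<and> skew_brace_isomorphic A (F_brace p)"
proof -
  obtain p where p: "prime p" "p dvd order A" and exp: "\<And>x. x \<in> carrier A \<Longrightarrow> x [^] p = \<one>"
    using left_simple_prime_exponent[OF fin simple comm] by blast
  have trivial: "lambda_map A a x = x" if "a \<in> carrier A" "x \<in> carrier A" for a x
    using left_simple_lambda_trivial[OF fin simple p exp] that by blast
  obtain g where g: "g \<in> carrier A" "ord g = p"
    using Cauchy_element_of_prime_order[OF fin p] by blast
  have "g \<noteq> \<one>" using g p(1) by auto
  then have "carrier A = range (\<lambda>k::int. g [^] k)"
    using left_simple_imp_cyclic[OF simple trivial] g(1) by blast
  then have "skew_brace_isomorphic A (F_brace p)"
    using cyclic_trivial_isomorphic_F_brace[OF p(1) g] by (simp add: circ_eq_mult_lambda trivial)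
  then show ?thesis using p(1) by blast
qed

lemma F_brace_left_simple: "prime p \<Longrightarrow> left_simple (F_brace p)"
  using F_brace_comm_group[of p]
  by (intro left_simple_prime_order) (auto simp: comm_group_def order_def F_brace_simps)

text \<open>
  Commutativity and the prime order pass through the additive isomorphism, and a skew
  brace of prime order is left-simple whatever its second operation is.
\<close>

lemma isomorphic_F_brace_imp_left_simple_abelian:
  assumes "skew_brace A" and p: "prime p" and iso: "skew_brace_isomorphic A (F_brace p)"
  shows "finite (carrier A) \<and> left_simple A \<and> comm_group A"
proof (intro conjI)
  interpret A: skew_brace A by fact
  interpret F: comm_group "F_brace p" using p by (rule F_brace_comm_group)
  obtain f where f: "f \<in> iso A (F_brace p)"
    using iso by (auto simp: skew_brace_isomorphic_def skew_brace_iso_def)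
  then have bij: "bij_betw f (carrier A) {0..<int p}"
    by (simp add: iso_def F_brace_simps[OF p])
  show "finite (carrier A)" using bij_betw_finite[OF bij] by simp
  show "left_simple A"
    using left_simple_prime_order[OF A.is_group] bij_betw_same_card[OF bij] p
    by (simp add: order_def)
  show "comm_group A"
    using A.iso_set_sym[OF f] F.iso_imp_comm_group A.is_monoid unfolding is_iso_def by blast
qed

theorem corollary1p3:
  shows "(\<forall>A :: 'a skew_brace. skew_brace A \<longrightarrow>
            (finite (carrier A) \<and> left_simple A \<and> comm_group A \<longleftrightarrow>
             (\<exists>p :: nat. prime p \<and> skew_brace_isomorphic A (F_brace p)))) \<and>
         (\<forall>p :: nat. prime p \<longrightarrow>
            skew_brace (F_brace p) \<and> finite (carrier (F_brace p)) \<and>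
            left_simple (F_brace p) \<and> comm_group (F_brace p))"
proof (intro conjI allI impI)
  fix A :: "'a skew_brace" assume A: "skew_brace A"
  show "finite (carrier A) \<and> left_simple A \<and> comm_group A \<longleftrightarrow>
      (\<exists>p. prime p \<and> skew_brace_isomorphic A (F_brace p))"
    using skew_brace.left_simple_abelian_isomorphic_F_brace[OF A]
      isomorphic_F_brace_imp_left_simple_abelian[OF A] by blast
qed (simp_all add: F_brace_skew_brace F_brace_left_simple F_brace_comm_group F_brace_simps)

end
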